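(* The functions $$\mathcal E=\left.\left(\sum_{i=1}^n\dot q_i\frac{\partial\mathcal L}{\partial\dot q_i}-\mathcal L\right)\right|_{\dot q_{m+\nu}=\alpha_\nu,\ \nu=1,\dots,k}\qquad\text{and}\qquad \mathcal E^*=\sum_{r=1}^m\dot q_r\frac{\partial\mathcal L^*}{\partial\dot q_r}-\mathcal L^*,$$ both regarded as functions of $(q_1,\dots,q_n,\dot q_1,\dots,\dot q_m,t)$, are related by the formula $$\mathcal E^*=\mathcal E+\sum_{\nu=1}^k(\overline\alpha_\nu-\alpha_\nu)\frac{\partial\mathcal L}{\partial\dot q_{m+\nu}},\qquad \overline\alpha_\nu=\sum_{r=1}^m\frac{\partial\alpha_\nu}{\partial\dot q_r}\dot q_r,$$ where $\partial\mathcal L/\partial\dot q_{m+\nu}$ is evaluated at $\dot q_{m+\mu}=\alpha_\mu$, $\mu=1,\dots,k$.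
   Context: Let $n>k\ge1$ be integers and $m=n-k$. $T(q,\dot q,t)$ is the kinetic energy of a mechanical system with Lagrangian coordinates $q=(q_1,\dots,q_n)$ and generalized velocities $\dot q=(\dot q_1,\dots,\dot q_n)$, $U(q,t)$ is the potential of the forces, and $\mathcal L=T+U$. The system is subject to kinematic constraints in explicit form $\dot q_{m+\nu}=\alpha_\nu(q_1,\dots,q_n,\dot q_1,\dots,\dot q_m,t)$, $\nu=1,\dots,k$. The restricted kinetic energy is $$T^*(q_1,\dots,q_n,\dot q_1,\dots,\dot q_m,t)=T(q_1,\dots,q_n,\dot q_1,\dots,\dot q_m,\alpha_1,\dots,\alpha_k,t),$$ where each $\alpha_\nu$ is evaluated at $(q_1,\dots,q_n,\dot q_1,\dots,\dot q_m,t)$, and the restricted Lagrangian is $\mathcal L^*=T^*+U$, a function of $(q_1,\dots,q_n,\dot q_1,\dots,\dot q_m,t)$. All functions are assumed as smooth as needed. *)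

theory Defs
  imports "HOL-Analysis.Analysis"
begin

text \<open>
  The coordinates are indexed by the sum type \<open>'m + 'k\<close>, with \<open>m = CARD('m)\<close>, \<open>k = CARD('k)\<close> and
  \<open>n = m + k\<close>: \<open>Inl r\<close> is the \<open>r\<close>-th independent coordinate and \<open>Inr \<nu>\<close> is the one with number
  \<open>m + \<nu>\<close>. Since types are nonempty, \<open>m \<ge> 1\<close> and \<open>k \<ge> 1\<close>, that is, \<open>n > k \<ge> 1\<close>. Functions take
  positions, velocities and time as three separate arguments.
\<close>

definition velocity_deriv ::
    "('q \<Rightarrow> real ^ 'i::finite \<Rightarrow> real \<Rightarrow> real) \<Rightarrow> 'i \<Rightarrow> 'q \<Rightarrow> real ^ 'i \<Rightarrow> real \<Rightarrow> real" where
  "velocity_deriv F i q v t = deriv (\<lambda>s. F q (\<chi> j. if j = i then s else v $ j) t) (v $ i)"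

definition full_velocity :: "real ^ 'm \<Rightarrow> real ^ 'k \<Rightarrow> real ^ ('m::finite + 'k::finite)" where
  "full_velocity v w = (\<chi> i. case i of Inl r \<Rightarrow> v $ r | Inr \<nu> \<Rightarrow> w $ \<nu>)"

definition constrained ::
    "('q \<Rightarrow> real ^ 'm \<Rightarrow> real \<Rightarrow> real ^ 'k)
      \<Rightarrow> ('q \<Rightarrow> real ^ ('m::finite + 'k::finite) \<Rightarrow> real \<Rightarrow> real)
      \<Rightarrow> 'q \<Rightarrow> real ^ 'm \<Rightarrow> real \<Rightarrow> real" where
  "constrained \<alpha> F q v t = F q (full_velocity v (\<alpha> q v t)) t"

definition lagrangian ::
    "('q \<Rightarrow> 'v \<Rightarrow> real \<Rightarrow> real) \<Rightarrow> ('q \<Rightarrow> real \<Rightarrow> real) \<Rightarrow> 'q \<Rightarrow> 'v \<Rightarrow> real \<Rightarrow> real" where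
  "lagrangian T U q v t = T q v t + U q t"

definition energy ::
    "('q \<Rightarrow> real ^ 'i::finite \<Rightarrow> real \<Rightarrow> real) \<Rightarrow> 'q \<Rightarrow> real ^ 'i \<Rightarrow> real \<Rightarrow> real" where
  "energy F q v t = (\<Sum>i\<in>UNIV. v $ i * velocity_deriv F i q v t) - F q v t"

text \<open>
  In \<open>restricted_energy\<close> the velocities are differentiated first and the constraints are substituted
  afterwards; in \<open>energy_of_restricted\<close> the substitution precedes the differentiation.
\<close>

definition restricted_energy ::
    "(real ^ ('m + 'k) \<Rightarrow> real ^ ('m::finite + 'k::finite) \<Rightarrow> real \<Rightarrow> real)
      \<Rightarrow> (real ^ ('m + 'k) \<Rightarrow> real \<Rightarrow> real)
      \<Rightarrow> (real ^ ('m + 'k) \<Rightarrow> real ^ 'm \<Rightarrow> real \<Rightarrow> real ^ 'k)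
      \<Rightarrow> real ^ ('m + 'k) \<Rightarrow> real ^ 'm \<Rightarrow> real \<Rightarrow> real" where
  "restricted_energy T U \<alpha> = constrained \<alpha> (energy (lagrangian T U))"

definition energy_of_restricted ::
    "(real ^ ('m + 'k) \<Rightarrow> real ^ ('m::finite + 'k::finite) \<Rightarrow> real \<Rightarrow> real)
      \<Rightarrow> (real ^ ('m + 'k) \<Rightarrow> real \<Rightarrow> real)
      \<Rightarrow> (real ^ ('m + 'k) \<Rightarrow> real ^ 'm \<Rightarrow> real \<Rightarrow> real ^ 'k)
      \<Rightarrow> real ^ ('m + 'k) \<Rightarrow> real ^ 'm \<Rightarrow> real \<Rightarrow> real" where
  "energy_of_restricted T U \<alpha> = energy (lagrangian (constrained \<alpha> T) U)"

definition alpha_bar ::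
    "('q \<Rightarrow> real ^ 'm::finite \<Rightarrow> real \<Rightarrow> real ^ 'k::finite) \<Rightarrow> 'k \<Rightarrow> 'q \<Rightarrow> real ^ 'm \<Rightarrow> real \<Rightarrow> real" where
  "alpha_bar \<alpha> \<nu> q v t = (\<Sum>r\<in>UNIV. velocity_deriv (\<lambda>q v t. \<alpha> q v t $ \<nu>) r q v t * v $ r)"

end

theory Submission
  imports Defs
begin

text \<open>
  If a function of the velocity \<open>v\<close> has derivative \<open>D\<close> at \<open>v\<close>, its Euler sum
  \<open>\<Sum>i. v\<^sub>i * D e\<^sub>i\<close> is \<open>D v\<close>. Let \<open>D\<close> be the derivative of the Lagrangian at \<open>(v, \<alpha>)\<close> and \<open>A\<close>
  that of \<open>\<alpha>\<close> at \<open>v\<close>. By the chain rule the Euler sum of the restricted Lagrangian is \<open>D (v, A v)\<close>,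
  while differentiating before substituting gives \<open>D (v, \<alpha>)\<close>. The difference is
  \<open>D (0, A v - \<alpha>)\<close>, and \<open>A v\<close> is the vector of the \<open>alpha_bar\<close>.
\<close>

text \<open>Replacing the coordinate \<open>i\<close> of \<open>v\<close> by \<open>s\<close> moves
  along the line \<open>v + (s - v $ i) *\<^sub>R axis i 1\<close>, so the chain rule turns the
  one-variable \<open>deriv\<close> into a value of the total derivative.\<close>

lemma velocity_deriv_eq:
  assumes D: "((\<lambda>u. F q u t) has_derivative D) (at v)"
  shows "velocity_deriv F i q v t = D (axis i 1)"
proof -
  have line: "(\<chi> j. if j = i then s else v $ j) = v + (s - v $ i) *\<^sub>R axis i 1" for s
    by (simp add: vec_eq_iff axis_def)
  have "((\<lambda>s. v + (s - v $ i) *\<^sub>R axis i 1) has_derivative (\<lambda>s. s *\<^sub>R axis i 1)) (at (v $ i))"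
    by (auto intro!: derivative_eq_intros)
  moreover have "((\<lambda>u. F q u t) has_derivative D) (at (v + (v $ i - v $ i) *\<^sub>R axis i 1))"
    using D by simp
  ultimately have "((\<lambda>s. F q (v + (s - v $ i) *\<^sub>R axis i 1) t) has_derivative
      (\<lambda>s. D (s *\<^sub>R axis i 1))) (at (v $ i))"
    by (rule has_derivative_compose)
  \<comment> \<open>Multiplication by a constant is the shape in which
    \<open>has_field_derivative\<close> unfolds.\<close>
  moreover have "(\<lambda>s. D (s *\<^sub>R axis i 1)) = (*) (D (axis i 1))"
    using has_derivative_linear[OF D] by (simp add: linear_scale fun_eq_iff mult.commute)
  ultimately have "((\<lambda>s. F q (v + (s - v $ i) *\<^sub>R axis i 1) t) has_field_derivative D (axis i 1))
      (at (v $ i))"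
    by (simp add: has_field_derivative_def)
  then show ?thesis
    unfolding velocity_deriv_def line by (rule DERIV_imp_deriv)
qed

lemma linear_sum_axis:
  fixes D :: "real ^ 'i::finite \<Rightarrow> real"
  assumes "linear D"
  shows "(\<Sum>i\<in>UNIV. h $ i * D (axis i 1)) = D h"
proof -
  have "D h = D (\<Sum>i\<in>UNIV. (h $ i) *\<^sub>R axis i 1)"
    by (simp add: basis_expansion flip: scalar_mult_eq_scaleR)
  also have "\<dots> = (\<Sum>i\<in>UNIV. h $ i * D (axis i 1))"
    using assms by (simp add: linear_sum linear_scale)
  finally show ?thesis by simp
qed

lemma energy_eq:
  assumes "((\<lambda>u. F q u t) has_derivative D) (at v)"
  shows "energy F q v t = D v - F q v t"
  unfolding energy_def velocity_deriv_eq[of F q t, OF assms]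
  using linear_sum_axis[OF has_derivative_linear[OF assms]] by simp

lemma full_velocity_diff:
  "full_velocity v w - full_velocity v' w' = full_velocity (v - v') (w - w')"
  by (simp add: full_velocity_def vec_eq_iff split: sum.split)

lemma bounded_linear_full_velocity:
  "bounded_linear (\<lambda>p. full_velocity (fst p) (snd p) :: real ^ ('m::finite + 'k::finite))"
  by (rule linear_conv_bounded_linear[THEN iffD1], rule linearI)
    (simp_all add: full_velocity_def vec_eq_iff split: sum.split)

text \<open>The \<open>Inl\<close> components of \<open>full_velocity 0 w\<close> vanish, so only
  the dependent coordinates survive in the basis expansion.\<close>

lemma linear_sum_Inr_axis:
  fixes D :: "real ^ ('m::finite + 'k::finite) \<Rightarrow> real"
  assumes "linear D"
  shows "(\<Sum>\<nu>\<in>UNIV. w $ \<nu> * D (axis (Inr \<nu>) 1)) = D (full_velocity 0 w)"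
proof -
  \<comment> \<open>The index set is written as a disjoint sum so that \<open>sum.Plus\<close> can
    split it.\<close>
  have "D (full_velocity 0 w) = (\<Sum>i\<in>UNIV <+> UNIV. full_velocity 0 w $ i * D (axis i 1))"
    using linear_sum_axis[OF assms, of "full_velocity 0 w"] by simp
  also have "\<dots> = (\<Sum>\<nu>\<in>UNIV. w $ \<nu> * D (axis (Inr \<nu>) 1))"
    by (subst sum.Plus) (simp_all add: full_velocity_def)
  finally show ?thesis by simp
qed

text \<open>Chain rule: the independent velocities enter \<open>F\<close> both directly and through
  \<alpha>, hence the two blocks \<open>h\<close> and \<open>A h\<close>.\<close>

lemma constrained_has_derivative:
  assumes D: "((\<lambda>u. F q u t) has_derivative D) (at (full_velocity v (\<alpha> q v t)))"
    and A: "((\<lambda>w. \<alpha> q w t) has_derivative A) (at v)"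
  shows "((\<lambda>w. constrained \<alpha> F q w t) has_derivative (\<lambda>h. D (full_velocity h (A h)))) (at v)"
proof -
  have "((\<lambda>w. full_velocity w (\<alpha> q w t)) has_derivative (\<lambda>h. full_velocity h (A h))) (at v)"
    using bounded_linear.has_derivative[OF bounded_linear_full_velocity
        has_derivative_Pair[OF has_derivative_ident A]] by simp
  then show ?thesis
    unfolding constrained_def using D by (rule has_derivative_compose)
qed

lemma alpha_bar_eq:
  assumes A: "((\<lambda>w. \<alpha> q w t) has_derivative A) (at v)"
  shows "alpha_bar \<alpha> \<nu> q v t = A v $ \<nu>"
proof -
  have comp: "((\<lambda>w. \<alpha> q w t $ \<nu>) has_derivative (\<lambda>h. A h $ \<nu>)) (at v)"
    using bounded_linear.has_derivative[OF bounded_linear_vec_nth A] .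
  show ?thesis
    unfolding alpha_bar_def
      velocity_deriv_eq[of "\<lambda>q v t. \<alpha> q v t $ \<nu>" q t, OF comp]
    using linear_sum_axis[OF has_derivative_linear[OF comp], of v] by (simp add: mult.commute)
qed

text \<open>The potential does not depend on velocities, so substituting the constraints commutes
  with adding it.\<close>

lemma lagrangian_constrained:
  "lagrangian (constrained \<alpha> T) U = constrained \<alpha> (lagrangian T U)"
  by (simp add: fun_eq_iff lagrangian_def constrained_def)

theorem proposition3:
  fixes T :: "real ^ ('m::finite + 'k::finite) \<Rightarrow> real ^ ('m + 'k) \<Rightarrow> real \<Rightarrow> real"
    and U :: "real ^ ('m + 'k) \<Rightarrow> real \<Rightarrow> real"
    and \<alpha> :: "real ^ ('m + 'k) \<Rightarrow> real ^ 'm \<Rightarrow> real \<Rightarrow> real ^ 'k"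
    and \<Omega> :: "((real ^ ('m + 'k)) \<times> (real ^ 'm) \<times> real) set"
  assumes T_differentiable: "\<And>q v t. (q, v, t) \<in> \<Omega> \<Longrightarrow>
      (\<lambda>u. T q u t) differentiable (at (full_velocity v (\<alpha> q v t)))"
    and alpha_differentiable: "\<And>q v t. (q, v, t) \<in> \<Omega> \<Longrightarrow> (\<lambda>w. \<alpha> q w t) differentiable (at v)"
  shows "\<forall>(q, v, t) \<in> \<Omega>.
      energy_of_restricted T U \<alpha> q v t =
        restricted_energy T U \<alpha> q v t
        + (\<Sum>\<nu>\<in>UNIV. (alpha_bar \<alpha> \<nu> q v t - \<alpha> q v t $ \<nu>)
             * constrained \<alpha> (velocity_deriv (lagrangian T U) (Inr \<nu>)) q v t)"
proof (intro ballI, clarify)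
  fix q v t
  assume mem: "(q, v, t) \<in> \<Omega>"
  obtain D where "((\<lambda>u. T q u t) has_derivative D) (at (full_velocity v (\<alpha> q v t)))"
    using T_differentiable[OF mem] unfolding differentiable_def by blast
  \<comment> \<open>\<open>U q t\<close> is constant in \<open>u\<close>, so \<open>T\<close> and
    the Lagrangian share the derivative \<open>D\<close>.\<close>
  then have D: "((\<lambda>u. lagrangian T U q u t) has_derivative D) (at (full_velocity v (\<alpha> q v t)))"
    unfolding lagrangian_def by (auto intro!: derivative_eq_intros)
  obtain A where A: "((\<lambda>w. \<alpha> q w t) has_derivative A) (at v)"
    using alpha_differentiable[OF mem] unfolding differentiable_def by blast
  note lin = has_derivative_linear[OF D]
  let ?L = "constrained \<alpha> (lagrangian T U) q v t"
  \<comment> \<open>Both energies subtract the same value \<open>?L\<close>, which cancels when they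
    are compared.\<close>
  have "energy_of_restricted T U \<alpha> q v t = D (full_velocity v (A v)) - ?L"
    unfolding energy_of_restricted_def lagrangian_constrained
    by (rule energy_eq[of "constrained \<alpha> (lagrangian T U)" q t,
          OF constrained_has_derivative[of "lagrangian T U" q t D v \<alpha>, OF D A]])
  moreover have "restricted_energy T U \<alpha> q v t = D (full_velocity v (\<alpha> q v t)) - ?L"
    unfolding restricted_energy_def constrained_def by (rule energy_eq[of "lagrangian T U" q t, OF D])
  moreover have "(\<Sum>\<nu>\<in>UNIV. (alpha_bar \<alpha> \<nu> q v t - \<alpha> q v t $ \<nu>)
      * constrained \<alpha> (velocity_deriv (lagrangian T U) (Inr \<nu>)) q v t)
      = D (full_velocity 0 (A v - \<alpha> q v t))"
    using linear_sum_Inr_axis[OF lin, of "A v - \<alpha> q v t"]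
    by (simp add: constrained_def velocity_deriv_eq[of "lagrangian T U" q t, OF D]
        alpha_bar_eq[of \<alpha> q t, OF A])
  \<comment> \<open>The two full velocities agree in the independent block \<open>v\<close>, so
    their difference has zero there.\<close>
  moreover have "D (full_velocity 0 (A v - \<alpha> q v t))
      = D (full_velocity v (A v)) - D (full_velocity v (\<alpha> q v t))"
    by (simp add: full_velocity_diff flip: linear_diff[OF lin])
  ultimately show "energy_of_restricted T U \<alpha> q v t = restricted_energy T U \<alpha> q v t
      + (\<Sum>\<nu>\<in>UNIV. (alpha_bar \<alpha> \<nu> q v t - \<alpha> q v t $ \<nu>)
          * constrained \<alpha> (velocity_deriv (lagrangian T U) (Inr \<nu>)) q v t)"
    by simp
qed

end
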